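(* Let $n\in\mathbb{N}$, let $H$ be any real or complex Hilbert space with inner product $\langle\cdot,\cdot\rangle$, and let $a_1,\dots,a_n\in H$ be unit vectors. Assume that the choice of signs $\epsilon=(1,1,\dots,1)$ gives maximal length among the vectors $a_\epsilon=\sum_{j=1}^n\epsilon_j a_j$, i.e. $\|a_1+\cdots+a_n\|\ge \|a_\epsilon\|$ for every choice of signs $\epsilon$. Put $y_j:=\langle \sum_{k=1}^n a_k, a_j\rangle$ for $1\le j\le n$ (under the maximality assumption these are real numbers with $y_j\ge 1$). Assume also that $y_j\le 3.5$ for $j=1,\dots,n$. Then the polynomial $P_n(x)=\langle x,a_1\rangle\langle x,a_2\rangle\cdots\langle x,a_n\rangle$ satisfies $$\|P_n\|\ge n^{-n/2},$$ with equality only when $y_j=1$ for all $j=1,\dots,n$, that is, only when $\{a_j\}_{j=1}^n$ is an orthonormal system.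
   Context: A choice of signs is an $n$-tuple $\epsilon=(\epsilon_1,\dots,\epsilon_n)$ with $\epsilon_j\in\{-1,1\}$ if $H$ is real, and with $\epsilon_j\in\mathbb{C}$, $|\epsilon_j|=1$ (i.e. $\epsilon_j=e^{i\varphi_j}$, $\varphi_j\in[0,2\pi)$) if $H$ is complex. The norm of the homogeneous polynomial $P_n$ on $H$ is $\|P_n\|=\sup\{|P_n(x)|: x\in H,\ \|x\|\le 1\}$. *)

theory Defs
  imports "HOL-Analysis.Analysis"
begin

text \<open>
  A complex inner product space is presented on top of its underlying real inner product space,
  whose scalar multiplication is the restriction of the complex one and whose inner product is
  the real part of the complex one. Norm, topology and completeness are thus the library's, and
  the positive definiteness of \<open>cinner\<close> is that of \<open>inner\<close> (as \<open>cinner x x\<close> is real by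
  \<open>cinner_commute\<close>). The inner product is linear in the \<^emph>\<open>first\<close> argument, so that
  \<open>\<lambda>x. cinner x a\<close> is a linear form. Hilbert spaces are the types of sort
  \<open>{real_inner, complete_space}\<close> and \<open>{complex_inner, complete_space}\<close>.
\<close>

class complex_inner = real_inner +
  fixes scaleC :: "complex \<Rightarrow> 'a \<Rightarrow> 'a"  (infixr "*\<^sub>C" 75)
    and cinner :: "'a \<Rightarrow> 'a \<Rightarrow> complex"
  assumes scaleC_add_right: "c *\<^sub>C (x + y) = c *\<^sub>C x + c *\<^sub>C y"
    and scaleC_add_left: "(c + d) *\<^sub>C x = c *\<^sub>C x + d *\<^sub>C x"
    and scaleC_scaleC: "c *\<^sub>C (d *\<^sub>C x) = (c * d) *\<^sub>C x"
    and scaleC_one: "1 *\<^sub>C x = x"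
    and scaleR_scaleC: "r *\<^sub>R x = complex_of_real r *\<^sub>C x"
    and cinner_commute: "cinner x y = cnj (cinner y x)"
    and cinner_add_left: "cinner (x + y) z = cinner x z + cinner y z"
    and cinner_scaleC_left: "cinner (c *\<^sub>C x) y = c * cinner x y"
    and inner_eq_Re_cinner: "inner x y = Re (cinner x y)"

instantiation complex :: complex_inner
begin

definition scaleC_complex :: "complex \<Rightarrow> complex \<Rightarrow> complex"
  where "scaleC_complex c x = c * x"

definition cinner_complex :: "complex \<Rightarrow> complex \<Rightarrow> complex"
  where "cinner_complex x y = x * cnj y"

instance
  by standard
    (simp_all add: scaleC_complex_def cinner_complex_def inner_complex_def algebra_simps
      scaleR_conv_of_real)

end

text \<open>
  The supremum is the conditionally complete one of \<open>real\<close>, hence meaningful only for functions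
  that are bounded on the unit ball; finite products of continuous linear forms are.
\<close>

definition sup_norm :: "('a::real_normed_vector \<Rightarrow> 'b::real_normed_vector) \<Rightarrow> real"
  where "sup_norm P = (SUP x\<in>{x. norm x \<le> 1}. norm (P x))"

end

theory Submission imports Defs begin

text \<open>
  Evaluating at \<open>x = s / \<parallel>s\<parallel>\<close> with \<open>s = \<Sum>a\<^sub>j\<close> gives \<open>\<Prod>y\<^sub>j / \<parallel>s\<parallel>\<^sup>n\<close>, where \<open>\<parallel>s\<parallel>\<^sup>2 = \<Sum>y\<^sub>j\<close>.
  If \<open>m\<close> is the mean of the \<open>y\<^sub>j\<close>, the claim becomes \<open>\<Sum>ln y\<^sub>j \<ge> (n/2) ln m\<close>. As \<open>ln m \<le> m - 1\<close>, it
  suffices that \<open>ln y \<ge> (y - 1) / 2\<close> on \<open>[1, 7/2]\<close>; by concavity this only has to be checked at the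
  end points, and it is strict except at \<open>1\<close>. Comparing \<open>s\<close> with the sum obtained by changing one or
  two signs gives \<open>y\<^sub>j \<ge> 1\<close> and, if all \<open>y\<^sub>j = 1\<close>, the orthogonality.
\<close>

section \<open>Logarithmic estimates for the numbers y_j\<close>

lemma ln_gt_half_minus_one:
  fixes y :: real
  assumes "1 < y" "y \<le> 7 / 2"
  shows "(y - 1) / 2 < ln y"
proof -
  define t where "t = (y - 1) / (5 / 2)"
  have t: "0 < t" "t \<le> 1" and y: "y = (1 - t) *\<^sub>R 1 + t *\<^sub>R (7 / 2)"
    using assms by (auto simp: t_def field_simps)
  \<comment> \<open>The chord of ln over [1, 7/2] has slope above 1/2 exactly when ln (7/2) > 5/4.
    The margin is narrow: ln (7/2) is about 1.2528.\<close>
  have "5 / 4 < ln (7 / 2 :: real)"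
    using ln_approx_bounds[of "7 / 2" 4] by (simp add: eval_nat_numeral)
  then have "t * (5 / 4) < t * ln (7 / 2)"
    using t by simp
  also have "\<dots> \<le> ln y"
    unfolding y using concave_onD[OF ln_concave, of t 1 "7 / 2"] t by simp
  finally show ?thesis by (simp add: t_def)
qed

lemma mean_powr_le_prod:
  fixes y :: "'i \<Rightarrow> real"
  assumes "finite A" "A \<noteq> {}" and y: "\<And>j. j \<in> A \<Longrightarrow> 1 \<le> y j" "\<And>j. j \<in> A \<Longrightarrow> y j \<le> 7 / 2"
  defines "n \<equiv> real (card A)"
  shows "((\<Sum>j\<in>A. y j) / n) powr (n / 2) \<le> (\<Prod>j\<in>A. y j)"
    and "((\<Sum>j\<in>A. y j) / n) powr (n / 2) = (\<Prod>j\<in>A. y j) \<Longrightarrow> j \<in> A \<Longrightarrow> y j = 1"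
proof -
  define m where "m = (\<Sum>j\<in>A. y j) / n"
  have n: "n > 0" using assms(1,2) by (simp add: n_def card_gt_0_iff)
  have "(\<Sum>j\<in>A. 1) \<le> (\<Sum>j\<in>A. y j)" by (intro sum_mono y)
  then have m: "m \<ge> 1" using n by (simp add: m_def n_def)
  have pos: "(\<Prod>j\<in>A. y j) > 0" using y(1) by (intro prod_pos) force
  have gt: "(y j - 1) / 2 < ln (y j)" if "j \<in> A" "y j \<noteq> 1" for j
    using ln_gt_half_minus_one y[OF that(1)] that(2) by force
  have ge: "(y j - 1) / 2 \<le> ln (y j)" if "j \<in> A" for j
    using gt[OF that] by (cases "y j = 1") auto
  have "n / 2 * ln m \<le> n / 2 * (m - 1)"
    using n m by (intro mult_left_mono ln_le_minus_one) auto
  \<comment> \<open>By linearity the bound in the mean is a sum of bounds in the single y_j, so the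
    comparison with the sum of the logarithms can be made term by term.\<close>
  also have "\<dots> = (\<Sum>j\<in>A. (y j - 1) / 2)"
    using n by (simp add: m_def n_def sum_subtractf flip: sum_divide_distrib)
      (simp add: field_simps)
  finally have le: "n / 2 * ln m \<le> (\<Sum>j\<in>A. (y j - 1) / 2)" .
  have ln_prod: "ln (\<Prod>j\<in>A. y j) = (\<Sum>j\<in>A. ln (y j))"
    using y(1) assms(1) by (intro ln_prod) force+
  have ln_powr: "ln (m powr (n / 2)) = n / 2 * ln m"
    using m by (simp add: ln_powr)
  have powr_pos: "m powr (n / 2) > 0" using m by simp
  have "ln (m powr (n / 2)) \<le> ln (\<Prod>j\<in>A. y j)"
    using le sum_mono[OF ge] unfolding ln_prod ln_powr by (rule order_trans)
  then show "((\<Sum>j\<in>A. y j) / n) powr (n / 2) \<le> (\<Prod>j\<in>A. y j)"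
    unfolding ln_le_cancel_iff[OF powr_pos pos] by (simp only: m_def)
  assume eq: "((\<Sum>j\<in>A. y j) / n) powr (n / 2) = (\<Prod>j\<in>A. y j)" and j: "j \<in> A"
  show "y j = 1"
  \<comment> \<open>A single y_j different from 1 makes the termwise estimate strict in the sum, so
    the logarithms of the two sides could not agree.\<close>
  proof (rule ccontr)
    assume "y j \<noteq> 1"
    then have "(\<Sum>j\<in>A. (y j - 1) / 2) < (\<Sum>j\<in>A. ln (y j))"
      using ge gt j assms(1) by (intro sum_strict_mono_ex1) auto
    then show False
      using le eq ln_powr ln_prod by (simp add: m_def)
  qed
qed

section \<open>The value of the product at the normalised sum\<close>

text \<open>Pairing \<open>s\<close> with itself shows that the y_j add up to
  \<open>norm s ^ 2\<close>. Their mean is therefore \<open>norm s ^ 2 / n\<close>, whose power n/2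
  is \<open>norm s ^ card A * n powr (- (n / 2))\<close>; the factor \<open>norm s ^ card A\<close>
  is the one that homogeneity takes out of the product.\<close>

lemma prod_normalised_sum:
  fixes a :: "'i \<Rightarrow> 'r::real_inner"
  assumes "finite A" "A \<noteq> {}"
    and y: "\<And>j. j \<in> A \<Longrightarrow> 1 \<le> inner (\<Sum>k\<in>A. a k) (a j)"
      "\<And>j. j \<in> A \<Longrightarrow> inner (\<Sum>k\<in>A. a k) (a j) \<le> 7 / 2"
  defines "s \<equiv> \<Sum>k\<in>A. a k" and "n \<equiv> real (card A)"
  shows "n powr (- (n / 2)) \<le> (\<Prod>j\<in>A. inner (s /\<^sub>R norm s) (a j))"
    and "n powr (- (n / 2)) = (\<Prod>j\<in>A. inner (s /\<^sub>R norm s) (a j)) \<Longrightarrow> j \<in> A \<Longrightarrow> inner s (a j) = 1"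
proof -
  have n: "n > 0" using assms(1,2) by (simp add: n_def card_gt_0_iff)
  have S: "(\<Sum>j\<in>A. inner s (a j)) = norm s ^ 2"
    by (simp add: s_def inner_sum_right dot_square_norm[symmetric])
  have "norm s ^ 2 > 0"
    unfolding S[symmetric] using assms(1,2) y(1) by (intro sum_pos) (force simp: s_def)+
  then have s: "norm s > 0" by simp
  have "(norm s ^ 2) powr (n / 2) = norm s ^ card A"
    using powr_powr[of "norm s" 2 "n / 2"] s by (simp add: n_def powr_realpow)
  then have eq: "((norm s ^ 2) / n) powr (n / 2) = norm s ^ card A * n powr (- (n / 2))"
    using n by (simp add: powr_divide powr_minus_divide)
  have prod: "(\<Prod>j\<in>A. inner (s /\<^sub>R norm s) (a j)) = (\<Prod>j\<in>A. inner s (a j)) / norm s ^ card A"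
    by (simp add: prod_dividef flip: divide_inverse_commute)
  note * = mean_powr_le_prod[of A "\<lambda>j. inner s (a j)", folded n_def, unfolded S eq]
  show "n powr (- (n / 2)) \<le> (\<Prod>j\<in>A. inner (s /\<^sub>R norm s) (a j))"
    using *(1) assms s unfolding prod by (simp add: field_simps)
  show "inner s (a j) = 1"
    if "n powr (- (n / 2)) = (\<Prod>j\<in>A. inner (s /\<^sub>R norm s) (a j))" "j \<in> A"
  proof (rule *(2)[OF assms(1,2) y[folded s_def] _ that(2)])
    show "norm s ^ card A * n powr (- (n / 2)) = (\<Prod>j\<in>A. inner s (a j))"
      using that(1) s unfolding prod by (simp add: nonzero_eq_divide_eq mult.commute)
  qed
qed

text \<open>The bound \<open>C\<close> makes the supremum a genuine one, so that it dominates every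
  value on the unit ball.\<close>

lemma norm_le_sup_norm:
  assumes "\<And>x. norm x \<le> 1 \<Longrightarrow> norm (P x) \<le> C" "norm x \<le> 1"
  shows "norm (P x) \<le> sup_norm P"
  unfolding sup_norm_def using assms by (intro cSUP_upper bdd_aboveI2[where M = C]) auto

section \<open>Maximality under real signs\<close>

definition longest_sum :: "'i set \<Rightarrow> ('i \<Rightarrow> 'r::real_inner) \<Rightarrow> bool"
  where "longest_sum A a \<longleftrightarrow> (\<forall>\<epsilon>. (\<forall>j\<in>A. \<epsilon> j \<in> {-1, 1}) \<longrightarrow>
    norm (\<Sum>j\<in>A. \<epsilon> j *\<^sub>R a j) \<le> norm (\<Sum>j\<in>A. a j))"

text \<open>Squaring and expanding cancels the square of \<open>s\<close>. Maximality enters in this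
  form, with \<open>f\<close> the amount by which a change of signs lowers the sum.\<close>

lemma inner_le_if_norm_diff_le:
  fixes s f :: "'r::real_inner"
  assumes "norm (s - f) \<le> norm s"
  shows "inner f f \<le> 2 * inner s f"
  using assms by (simp add: norm_le inner_diff_left inner_diff_right inner_commute)

text \<open>Flipping the signs on \<open>B\<close> subtracts twice the partial sum over
  \<open>B\<close>; the resulting factor 4 cancels. Singletons and pairs are the cases of
  interest.\<close>

lemma longest_sum_subset:
  assumes "finite A" "longest_sum A a" "B \<subseteq> A"
  shows "inner (\<Sum>j\<in>B. a j) (\<Sum>j\<in>B. a j) \<le> inner (\<Sum>j\<in>A. a j) (\<Sum>j\<in>B. a j)"
proof -
  define \<epsilon> :: "'a \<Rightarrow> real" where "\<epsilon> j = (if j \<in> B then -1 else 1)" for j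
  have "\<epsilon> j *\<^sub>R a j = a j - 2 *\<^sub>R (if j \<in> B then a j else 0)" for j
    by (simp add: \<epsilon>_def scaleR_2)
  then have "(\<Sum>j\<in>A. \<epsilon> j *\<^sub>R a j) = (\<Sum>j\<in>A. a j) - 2 *\<^sub>R (\<Sum>j\<in>A. if j \<in> B then a j else 0)"
    by (simp add: sum_subtractf scaleR_right.sum)
  also have "(\<Sum>j\<in>A. if j \<in> B then a j else 0) = (\<Sum>j\<in>B. a j)"
    using assms(1,3) by (simp add: sum.inter_restrict[symmetric] Int_absorb1)
  finally have "norm ((\<Sum>j\<in>A. a j) - 2 *\<^sub>R (\<Sum>j\<in>B. a j)) \<le> norm (\<Sum>j\<in>A. a j)"
    using assms(2) unfolding longest_sum_def by (metis \<epsilon>_def insertCI)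
  from inner_le_if_norm_diff_le[OF this] show ?thesis by simp
qed

lemma longest_sum_inner_ge_1:
  assumes "finite A" "longest_sum A a" "j \<in> A" "norm (a j) = 1"
  shows "1 \<le> inner (\<Sum>k\<in>A. a k) (a j)"
  using longest_sum_subset[of A a "{j}"] assms by (simp add: dot_square_norm)

text \<open>Flipping the pair k, j gives 2 + 2 \<langle>a_k, a_j\<rangle> \<le> 2, so the
  off-diagonal products are nonpositive. For fixed j they add up to y_j - 1 = 0, hence each of them
  vanishes.\<close>

lemma longest_sum_orthogonal:
  assumes "finite A" "longest_sum A a" and unit: "\<And>j. j \<in> A \<Longrightarrow> norm (a j) = 1"
    and y: "\<And>j. j \<in> A \<Longrightarrow> inner (\<Sum>k\<in>A. a k) (a j) = 1"
    and ij: "i \<in> A" "j \<in> A" "i \<noteq> j"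
  shows "inner (a i) (a j) = 0"
proof -
  have le: "inner (a k) (a j) \<le> 0" if "k \<in> A - {j}" for k
    using longest_sum_subset[OF assms(1,2), of "{k, j}"] that ij unit[of k] unit[of j] y[of k] y[of j]
      dot_square_norm[of "a k"] dot_square_norm[of "a j"]
    by (auto simp: inner_add_left inner_add_right inner_commute)
  have "(\<Sum>k\<in>A. inner (a k) (a j)) = inner (a j) (a j) + (\<Sum>k\<in>A - {j}. inner (a k) (a j))"
    using assms(1) ij by (intro sum.remove)
  then have "(\<Sum>k\<in>A - {j}. inner (a k) (a j)) = 0"
    using y[of j] unit[of j] ij by (simp add: inner_sum_left dot_square_norm)
  then show ?thesis
    using sum_nonneg_eq_0_iff[of "A - {j}" "\<lambda>k. - inner (a k) (a j)"] le assms(1) ij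
    by (auto simp: sum_negf)
qed

text \<open>The Gram matrix is kept abstract as \<open>g\<close>, so that the same argument serves
  \<open>inner\<close> and \<open>cinner\<close>.\<close>

lemma orthonormal_imp_inner_sum:
  fixes A :: "'i set" and g :: "'i \<Rightarrow> 'i \<Rightarrow> 'b::semiring_1"
  assumes "finite A" "\<forall>i\<in>A. \<forall>j\<in>A. g i j = (if i = j then 1 else 0)" "j \<in> A"
  shows "(\<Sum>k\<in>A. g k j) = 1"
proof -
  have "(\<Sum>k\<in>A. g k j) = (\<Sum>k\<in>A. if k = j then 1 else 0)"
    using assms by (intro sum.cong) auto
  then show ?thesis using assms by simp
qed

lemma prod_norm_le_one:
  fixes f :: "'i \<Rightarrow> 'b::real_normed_field"
  assumes "\<And>j. j \<in> A \<Longrightarrow> norm (f j) \<le> 1"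
  shows "norm (\<Prod>j\<in>A. f j) \<le> 1"
  unfolding prod_norm[symmetric] using assms by (intro prod_le_1) auto

section \<open>Calculus of the complex inner product\<close>

lemma cinner_scaleR_left:
  fixes x y :: "'c::complex_inner"
  shows "cinner (r *\<^sub>R x) y = of_real r * cinner x y"
  by (simp add: scaleR_scaleC cinner_scaleC_left)

lemma cinner_scaleC_right:
  fixes x y :: "'c::complex_inner"
  shows "cinner x (c *\<^sub>C y) = cnj c * cinner x y"
  using cinner_commute[of x "c *\<^sub>C y"] cinner_commute[of x y] by (simp add: cinner_scaleC_left)

lemma cinner_add_right:
  fixes x y z :: "'c::complex_inner"
  shows "cinner x (y + z) = cinner x y + cinner x z"
  using cinner_commute[of x "y + z"] cinner_commute[of x y] cinner_commute[of x z]
  by (simp add: cinner_add_left)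

lemma cinner_self:
  fixes x :: "'c::complex_inner"
  shows "cinner x x = of_real (norm x ^ 2)"
proof -
  have "Im (cinner x x) = 0"
    using cinner_commute[of x x] by (simp add: complex_eq_iff)
  then show ?thesis
    by (simp add: complex_eq_iff dot_square_norm[symmetric] inner_eq_Re_cinner)
qed

lemma cinner_sum_left:
  fixes f :: "'i \<Rightarrow> 'c::complex_inner"
  shows "cinner (\<Sum>k\<in>A. f k) y = (\<Sum>k\<in>A. cinner (f k) y)"
proof -
  have "cinner 0 y = 0" using cinner_add_left[of 0 0 y] by simp
  then show ?thesis
    by (induction A rule: infinite_finite_induct) (simp_all add: cinner_add_left)
qed

lemma norm_scaleC:
  fixes x :: "'c::complex_inner"
  shows "norm (c *\<^sub>C x) = cmod c * norm x"
proof -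
  have "complex_of_real (norm (c *\<^sub>C x) ^ 2) = c * cnj c * of_real (norm x ^ 2)"
    by (simp only: cinner_scaleC_left cinner_scaleC_right mult_ac flip: cinner_self)
  also have "\<dots> = of_real ((cmod c * norm x) ^ 2)"
    by (simp add: power_mult_distrib flip: complex_norm_square)
  finally show ?thesis
    by (metis of_real_eq_iff norm_ge_zero mult_nonneg_nonneg power2_eq_iff_nonneg)
qed

text \<open>Rotating \<open>x\<close> by a suitable unit \<open>c\<close> makes the inner product
  real and nonnegative without changing any norm; the real Cauchy-Schwarz inequality then
  applies.\<close>

lemma norm_cinner_le:
  fixes x y :: "'c::complex_inner"
  shows "cmod (cinner x y) \<le> norm x * norm y"
proof (cases "cinner x y = 0")
  case False
  define c where "c = cnj (sgn (cinner x y))"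
  have c: "cmod c = 1" using False by (simp add: c_def norm_sgn)
  have "c * cinner x y = cmod (cinner x y)"
    using False unfolding c_def sgn_eq
    by (simp add: divide_simps power2_eq_square complex_norm_square mult_ac flip: complex_norm_square)
  then have "cmod (cinner x y) = inner (c *\<^sub>C x) y"
    by (simp add: inner_eq_Re_cinner cinner_scaleC_left)
  also have "\<dots> \<le> norm (c *\<^sub>C x) * norm y" by (rule norm_cauchy_schwarz)
  finally show ?thesis using c by (simp add: norm_scaleC)
qed simp

section \<open>Maximality under unimodular complex signs\<close>

definition longest_csum :: "'i set \<Rightarrow> ('i \<Rightarrow> 'c::complex_inner) \<Rightarrow> bool"
  where "longest_csum A b \<longleftrightarrow> (\<forall>\<epsilon>. (\<forall>j\<in>A. cmod (\<epsilon> j) = 1) \<longrightarrow>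
    norm (\<Sum>j\<in>A. \<epsilon> j *\<^sub>C b j) \<le> norm (\<Sum>j\<in>A. b j))"

text \<open>The signs -1 and 1 are unimodular. Hence the results for real signs hold in the
  underlying real space, where \<open>inner\<close> is the real part of
  \<open>cinner\<close>.\<close>

lemma longest_csum_imp_longest_sum:
  assumes "longest_csum A b"
  shows "longest_sum A b"
  unfolding longest_sum_def
proof (intro allI impI)
  fix \<epsilon> :: "'a \<Rightarrow> real"
  assume "\<forall>j\<in>A. \<epsilon> j \<in> {-1, 1}"
  then have "\<forall>j\<in>A. cmod (of_real (\<epsilon> j)) = 1" by auto
  with assms show "norm (\<Sum>j\<in>A. \<epsilon> j *\<^sub>R b j) \<le> norm (\<Sum>j\<in>A. b j)"
    unfolding longest_csum_def scaleR_scaleC by (elim allE[of _ "\<lambda>j. of_real (\<epsilon> j)"] mp)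
qed

text \<open>Writing the signs as \<open>1 - c j\<close> makes the sum of the
  \<open>c j *\<^sub>C b j\<close> the amount subtracted; \<open>c j = 0\<close> leaves a vector
  untouched.\<close>

lemma longest_csum_perturb:
  fixes b :: "'i \<Rightarrow> 'c::complex_inner"
  assumes "longest_csum A b" "\<And>j. j \<in> A \<Longrightarrow> cmod (1 - c j) = 1"
  shows "inner (\<Sum>j\<in>A. c j *\<^sub>C b j) (\<Sum>j\<in>A. c j *\<^sub>C b j)
    \<le> 2 * inner (\<Sum>j\<in>A. b j) (\<Sum>j\<in>A. c j *\<^sub>C b j)"
proof (rule inner_le_if_norm_diff_le)
  have "(1 - c j) *\<^sub>C b j = b j - c j *\<^sub>C b j" for j
    using scaleC_add_left[of "1 - c j" "c j" "b j"] by (simp add: scaleC_one algebra_simps)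
  then have "(\<Sum>j\<in>A. (1 - c j) *\<^sub>C b j) = (\<Sum>j\<in>A. b j) - (\<Sum>j\<in>A. c j *\<^sub>C b j)"
    by (simp add: sum_subtractf)
  then show "norm ((\<Sum>j\<in>A. b j) - (\<Sum>j\<in>A. c j *\<^sub>C b j)) \<le> norm (\<Sum>j\<in>A. b j)"
    using assms unfolding longest_csum_def by metis
qed

lemma scaleC_zero_left:
  fixes x :: "'c::complex_inner"
  shows "0 *\<^sub>C x = 0"
  using scaleC_add_left[of 0 0 x] by simp

text \<open>
  With \<open>z = \<langle>s, b\<^sub>j\<rangle> - 1\<close>, multiplying \<open>b\<^sub>j\<close> by a unit \<open>u\<close> gives \<open>Re (cnj u * z) \<le> Re z\<close>; the choice
  \<open>u = sgn z\<close> yields \<open>\<bar>z\<bar> \<le> Re z\<close>.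
\<close>
lemma longest_csum_cinner_real:
  fixes b :: "'i \<Rightarrow> 'c::complex_inner"
  assumes "finite A" "longest_csum A b" and j: "j \<in> A" and unit: "norm (b j) = 1"
  shows "cinner (\<Sum>k\<in>A. b k) (b j) \<in> \<real>"
proof -
  define y where "y = cinner (\<Sum>k\<in>A. b k) (b j)"
  define z where "z = y - 1"
  show ?thesis
  \<comment> \<open>For z = 0 the value \<open>sgn z\<close> is 0 and not a unit, but then y = 1 is
    real anyway.\<close>
  proof (cases "z = 0")
    case False
    define u where "u = sgn z"
    have u: "cmod u = 1" using False by (simp add: u_def norm_sgn)
    define c where "c k = (if k = j then 1 - u else 0)" for k
    have "(\<Sum>k\<in>A. c k *\<^sub>C b k) = (\<Sum>k\<in>A. if k = j then (1 - u) *\<^sub>C b j else 0)"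
      by (intro sum.cong) (auto simp: c_def scaleC_zero_left)
    then have sum: "(\<Sum>k\<in>A. c k *\<^sub>C b k) = (1 - u) *\<^sub>C b j"
      using assms(1) j by simp
    have "inner ((1 - u) *\<^sub>C b j) ((1 - u) *\<^sub>C b j) \<le> 2 * inner (\<Sum>k\<in>A. b k) ((1 - u) *\<^sub>C b j)"
      unfolding sum[symmetric] using assms(2) u
      by (intro longest_csum_perturb) (auto simp: c_def)
    then have "cmod (1 - u) ^ 2 \<le> 2 * Re (cnj (1 - u) * y)"
      by (simp add: dot_square_norm norm_scaleC unit inner_eq_Re_cinner cinner_scaleC_right y_def)
    moreover have "(Re u)\<^sup>2 + (Im u)\<^sup>2 = 1" using u cmod_power2[of u] by simp
    \<comment> \<open>As \<open>cmod (1 - u) ^ 2\<close> is 2 - 2 Re u, half the inequality reads 1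
      - Re u \<le> Re y - Re (cnj u * y); substituting y = z + 1 removes the constants.\<close>
    ultimately have "Re (cnj u * z) \<le> Re z"
      unfolding cmod_power2 z_def by (simp add: algebra_simps power2_eq_square)
    moreover have "cnj u * z = of_real (cmod z)"
      using False unfolding u_def sgn_eq
      by (simp add: divide_simps power2_eq_square mult_ac flip: complex_norm_square)
    ultimately have "cmod z \<le> Re z" by simp
    then have "Im z = 0" using cmod_eq_Re complex_Re_le_cmod[of z] cmod_power2[of z] by auto
    then show ?thesis
      by (simp add: z_def y_def complex_is_Real_iff)
  qed (simp add: z_def y_def)
qed

text \<open>
  Real signs only see \<open>Re \<langle>b\<^sub>i, b\<^sub>j\<rangle>\<close>. For the imaginary part, multiply \<open>b\<^sub>i\<close> by \<open>-1\<close> and \<open>b\<^sub>j\<close> by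
  \<open>\<plusminus>\<i>\<close>.
\<close>
lemma longest_csum_orthogonal:
  fixes b :: "'i \<Rightarrow> 'c::complex_inner"
  assumes "finite A" "longest_csum A b" and unit: "\<And>j. j \<in> A \<Longrightarrow> norm (b j) = 1"
    and y: "\<And>j. j \<in> A \<Longrightarrow> cinner (\<Sum>k\<in>A. b k) (b j) = 1"
    and ij: "i \<in> A" "j \<in> A" "i \<noteq> j"
  shows "cinner (b i) (b j) = 0"
proof -
  have Re: "Re (cinner (b i) (b j)) = 0"
    using longest_sum_orthogonal[OF assms(1) longest_csum_imp_longest_sum[OF assms(2)] unit _ ij] y
    by (simp add: inner_eq_Re_cinner)
  \<comment> \<open>The new signs are 1 - 2 = -1 at i and 1 - d at j. Since
    \<open>cmod d ^ 2 = 2 * Re d\<close>, the terms 4 + \<open>cmod d ^ 2\<close> and 4 + 2 Re d on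
    the two sides cancel, and only the cross term remains.\<close>
  have *: "Re (cnj d * cinner (b i) (b j)) \<le> 0" if d: "cmod (1 - d) = 1" "cmod d ^ 2 = 2 * Re d" for d
  proof -
    define c where "c k = (if k = i then 2 else if k = j then d else 0)" for k
    have "(\<Sum>k\<in>A. c k *\<^sub>C b k)
        = (\<Sum>k\<in>A. (if k = i then 2 *\<^sub>C b i else 0) + (if k = j then d *\<^sub>C b j else 0))"
      using ij by (intro sum.cong) (auto simp: c_def scaleC_zero_left)
    then have sum: "(\<Sum>k\<in>A. c k *\<^sub>C b k) = 2 *\<^sub>C b i + d *\<^sub>C b j"
      using assms(1) ij by (simp add: sum.distrib)
    have "inner (2 *\<^sub>C b i + d *\<^sub>C b j) (2 *\<^sub>C b i + d *\<^sub>C b j)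
        \<le> 2 * inner (\<Sum>k\<in>A. b k) (2 *\<^sub>C b i + d *\<^sub>C b j)"
      unfolding sum[symmetric] using assms(2) d
      by (intro longest_csum_perturb) (auto simp: c_def)
    moreover have "inner (2 *\<^sub>C b i + d *\<^sub>C b j) (2 *\<^sub>C b i + d *\<^sub>C b j)
        = 4 + cmod d ^ 2 + 2 * inner (2 *\<^sub>C b i) (d *\<^sub>C b j)"
      using ij unit dot_square_norm[of "2 *\<^sub>C b i"] dot_square_norm[of "d *\<^sub>C b j"]
      by (simp add: inner_add_left inner_add_right inner_commute norm_scaleC)
    moreover have "inner (2 *\<^sub>C b i) (d *\<^sub>C b j) = 2 * Re (cnj d * cinner (b i) (b j))"
      by (simp add: inner_eq_Re_cinner cinner_scaleC_left cinner_scaleC_right)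
    moreover have "inner (\<Sum>k\<in>A. b k) (2 *\<^sub>C b i + d *\<^sub>C b j) = 2 + Re d"
      using y ij by (simp add: inner_eq_Re_cinner cinner_add_right cinner_scaleC_right)
    ultimately show ?thesis using d(2) by simp
  qed
  \<comment> \<open>The signs 1 - d are here -\<i> and \<i>. With vanishing real part, the two
    inequalities say that the imaginary part and its negative are both nonpositive.\<close>
  show ?thesis
    using *[of "1 + \<i>"] *[of "1 - \<i>"] Re by (simp add: cmod_power2 complex_eq_iff)
qed

section \<open>Lower bounds for the norm of the product and the case of equality\<close>

text \<open>By Cauchy-Schwarz the product is bounded by 1 on the unit ball, so its value at the
  normalised sum is a lower bound for the supremum.\<close>

lemma sup_norm_prod_inner_ge:
  fixes a :: "'i \<Rightarrow> 'r::real_inner"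
  assumes A: "finite A" "A \<noteq> {}" and unit: "\<And>j. j \<in> A \<Longrightarrow> norm (a j) = 1"
    and max: "longest_sum A a"
    and le: "\<And>j. j \<in> A \<Longrightarrow> inner (\<Sum>k\<in>A. a k) (a j) \<le> 7 / 2"
  defines "n \<equiv> real (card A)" and "P \<equiv> \<lambda>x. \<Prod>j\<in>A. inner x (a j)"
  shows "n powr (- (n / 2)) \<le> sup_norm P"
    and "sup_norm P = n powr (- (n / 2)) \<Longrightarrow> j \<in> A \<Longrightarrow> inner (\<Sum>k\<in>A. a k) (a j) = 1"
proof -
  define s where "s = (\<Sum>k\<in>A. a k)"
  have y: "1 \<le> inner (\<Sum>k\<in>A. a k) (a j)" if "j \<in> A" for j
    using longest_sum_inner_ge_1[OF A(1) max that unit[OF that]] .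
  have "norm (P x) \<le> 1" if "norm x \<le> 1" for x
    unfolding P_def using that unit
    by (intro prod_norm_le_one) (metis Cauchy_Schwarz_ineq2 mult.right_neutral order_trans real_norm_def)
  moreover have "norm (s /\<^sub>R norm s) \<le> 1"
    unfolding sgn_div_norm[symmetric] by (simp add: norm_sgn)
  ultimately have "norm (P (s /\<^sub>R norm s)) \<le> sup_norm P"
    by (rule norm_le_sup_norm)
  then have sup: "P (s /\<^sub>R norm s) \<le> sup_norm P" by simp
  note * = prod_normalised_sum[OF A y le, folded s_def n_def]
  show "n powr (- (n / 2)) \<le> sup_norm P"
    using *(1) sup by (simp add: P_def)
  \<comment> \<open>Here the value at the normalised sum is squeezed between the lower bound and the
    supremum, so it attains the lower bound.\<close>
  show "inner (\<Sum>k\<in>A. a k) (a j) = 1" if "sup_norm P = n powr (- (n / 2))" "j \<in> A"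
    using *(1) *(2)[of j] sup that unfolding P_def s_def by linarith
qed

text \<open>Maximality makes every \<langle>s, b_j\<rangle> real. At the normalised sum the complex
  product thus equals the product of real inner products, and the real estimate applies.\<close>

lemma sup_norm_prod_cinner_ge:
  fixes b :: "'i \<Rightarrow> 'c::complex_inner"
  assumes A: "finite A" "A \<noteq> {}" and unit: "\<And>j. j \<in> A \<Longrightarrow> norm (b j) = 1"
    and max: "longest_csum A b"
    and le: "\<And>j. j \<in> A \<Longrightarrow> inner (\<Sum>k\<in>A. b k) (b j) \<le> 7 / 2"
  defines "n \<equiv> real (card A)" and "P \<equiv> \<lambda>x. \<Prod>j\<in>A. cinner x (b j)"
  shows "n powr (- (n / 2)) \<le> sup_norm P"
    and "sup_norm P = n powr (- (n / 2)) \<Longrightarrow> j \<in> A \<Longrightarrow> cinner (\<Sum>k\<in>A. b k) (b j) = 1"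
proof -
  define s where "s = (\<Sum>k\<in>A. b k)"
  have y: "1 \<le> inner (\<Sum>k\<in>A. b k) (b j)" if "j \<in> A" for j
    using longest_sum_inner_ge_1[OF A(1) longest_csum_imp_longest_sum[OF max] that unit[OF that]] .
  have real: "cinner s (b j) = of_real (inner s (b j))" if "j \<in> A" for j
    using longest_csum_cinner_real[OF A(1) max that unit[OF that]]
    by (simp add: s_def inner_eq_Re_cinner)
  have "norm (P x) \<le> 1" if "norm x \<le> 1" for x
    unfolding P_def using that unit
    by (intro prod_norm_le_one) (metis norm_cinner_le mult.right_neutral order_trans)
  moreover have "norm (s /\<^sub>R norm s) \<le> 1"
    unfolding sgn_div_norm[symmetric] by (simp add: norm_sgn)
  ultimately have "norm (P (s /\<^sub>R norm s)) \<le> sup_norm P"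
    by (rule norm_le_sup_norm)
  moreover have P: "P (s /\<^sub>R norm s) = of_real (\<Prod>j\<in>A. inner (s /\<^sub>R norm s) (b j))"
    unfolding P_def of_real_prod
    by (intro prod.cong) (simp_all add: cinner_scaleR_left real)
  ultimately have sup: "(\<Prod>j\<in>A. inner (s /\<^sub>R norm s) (b j)) \<le> sup_norm P"
    unfolding P norm_of_real by linarith
  note * = prod_normalised_sum[OF A y le, folded s_def n_def]
  show "n powr (- (n / 2)) \<le> sup_norm P"
    using *(1) sup by simp
  show "cinner (\<Sum>k\<in>A. b k) (b j) = 1" if "sup_norm P = n powr (- (n / 2))" "j \<in> A"
  proof -
    have "inner s (b j) = 1" using *(1) *(2)[of j] sup that by linarith
    then show ?thesis using real[OF that(2)] by (simp add: s_def)
  qed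
qed

section \<open>The real and the complex statement, with orthonormality as the equality
  condition\<close>

theorem theorem2:
  fixes n :: nat
    and a :: "nat \<Rightarrow> 'r::{real_inner, complete_space}"
    and b :: "nat \<Rightarrow> 'c::{complex_inner, complete_space}"
  assumes "n \<ge> 1"
  shows
    "((\<forall>j\<in>{1..n}. norm (a j) = 1) \<and>
      (\<forall>\<epsilon> :: nat \<Rightarrow> real. (\<forall>j\<in>{1..n}. \<epsilon> j \<in> {-1, 1}) \<longrightarrow>
         norm (\<Sum>j=1..n. \<epsilon> j *\<^sub>R a j) \<le> norm (\<Sum>j=1..n. a j)) \<and>
      (\<forall>j\<in>{1..n}. inner (\<Sum>k=1..n. a k) (a j) \<le> 7 / 2)
      \<longrightarrow>
      (\<forall>j\<in>{1..n}. inner (\<Sum>k=1..n. a k) (a j) \<ge> 1) \<and>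
      sup_norm (\<lambda>x. \<Prod>j=1..n. inner x (a j)) \<ge> real n powr (- (real n / 2)) \<and>
      (sup_norm (\<lambda>x. \<Prod>j=1..n. inner x (a j)) = real n powr (- (real n / 2)) \<longrightarrow>
         (\<forall>j\<in>{1..n}. inner (\<Sum>k=1..n. a k) (a j) = 1)) \<and>
      ((\<forall>j\<in>{1..n}. inner (\<Sum>k=1..n. a k) (a j) = 1) \<longleftrightarrow>
         (\<forall>i\<in>{1..n}. \<forall>j\<in>{1..n}. inner (a i) (a j) = (if i = j then 1 else 0))))
     \<and>
     ((\<forall>j\<in>{1..n}. norm (b j) = 1) \<and>
      (\<forall>\<epsilon> :: nat \<Rightarrow> complex. (\<forall>j\<in>{1..n}. norm (\<epsilon> j) = 1) \<longrightarrow>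
         norm (\<Sum>j=1..n. \<epsilon> j *\<^sub>C b j) \<le> norm (\<Sum>j=1..n. b j)) \<and>
      (\<forall>j\<in>{1..n}. Re (cinner (\<Sum>k=1..n. b k) (b j)) \<le> 7 / 2)
      \<longrightarrow>
      (\<forall>j\<in>{1..n}. cinner (\<Sum>k=1..n. b k) (b j) \<in> \<real> \<and>
                   Re (cinner (\<Sum>k=1..n. b k) (b j)) \<ge> 1) \<and>
      sup_norm (\<lambda>x. \<Prod>j=1..n. cinner x (b j)) \<ge> real n powr (- (real n / 2)) \<and>
      (sup_norm (\<lambda>x. \<Prod>j=1..n. cinner x (b j)) = real n powr (- (real n / 2)) \<longrightarrow>
         (\<forall>j\<in>{1..n}. cinner (\<Sum>k=1..n. b k) (b j) = 1)) \<and>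
      ((\<forall>j\<in>{1..n}. cinner (\<Sum>k=1..n. b k) (b j) = 1) \<longleftrightarrow>
         (\<forall>i\<in>{1..n}. \<forall>j\<in>{1..n}. cinner (b i) (b j) = (if i = j then 1 else 0))))"
proof (intro conjI[of "_ \<longrightarrow> _"] impI; elim conjE)
  let ?A = "{1..n}"
  have A: "finite ?A" "?A \<noteq> {}" using assms by auto
  assume unit: "\<forall>j\<in>?A. norm (a j) = 1"
    and max: "\<forall>\<epsilon> :: nat \<Rightarrow> real. (\<forall>j\<in>?A. \<epsilon> j \<in> {-1, 1}) \<longrightarrow>
      norm (\<Sum>j\<in>?A. \<epsilon> j *\<^sub>R a j) \<le> norm (\<Sum>j\<in>?A. a j)"
    and le: "\<forall>j\<in>?A. inner (\<Sum>k\<in>?A. a k) (a j) \<le> 7 / 2"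
  have max': "longest_sum ?A a" using max unfolding longest_sum_def .
  note rc = sup_norm_prod_inner_ge[OF A bspec[OF unit] max' bspec[OF le], simplified card_atLeastAtMost diff_Suc_1]
  show "(\<forall>j\<in>?A. inner (\<Sum>k\<in>?A. a k) (a j) \<ge> 1) \<and>
      sup_norm (\<lambda>x. \<Prod>j\<in>?A. inner x (a j)) \<ge> real n powr (- (real n / 2)) \<and>
      (sup_norm (\<lambda>x. \<Prod>j\<in>?A. inner x (a j)) = real n powr (- (real n / 2)) \<longrightarrow>
         (\<forall>j\<in>?A. inner (\<Sum>k\<in>?A. a k) (a j) = 1)) \<and>
      ((\<forall>j\<in>?A. inner (\<Sum>k\<in>?A. a k) (a j) = 1) \<longleftrightarrow>
         (\<forall>i\<in>?A. \<forall>j\<in>?A. inner (a i) (a j) = (if i = j then 1 else 0)))"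
  proof (intro conjI impI iffI ballI)
    show "1 \<le> inner (\<Sum>k\<in>?A. a k) (a j)" if "j \<in> ?A" for j
      using longest_sum_inner_ge_1[OF A(1) max' that] unit that by blast
    show "inner (a i) (a j) = (if i = j then 1 else 0)"
      if "\<forall>j\<in>?A. inner (\<Sum>k\<in>?A. a k) (a j) = 1" "i \<in> ?A" "j \<in> ?A" for i j
      using longest_sum_orthogonal[OF A(1) max' bspec[OF unit] bspec[OF that(1)] that(2,3)]
        unit that by (simp add: dot_square_norm)
    show "inner (\<Sum>k\<in>?A. a k) (a j) = 1"
      if "\<forall>i\<in>?A. \<forall>j\<in>?A. inner (a i) (a j) = (if i = j then 1 else 0)" "j \<in> ?A" for j
      unfolding inner_sum_left by (rule orthonormal_imp_inner_sum[OF A(1) that])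
  qed (use rc in auto)
next
  let ?A = "{1..n}"
  have A: "finite ?A" "?A \<noteq> {}" using assms by auto
  assume unit: "\<forall>j\<in>?A. norm (b j) = 1"
    and max: "\<forall>\<epsilon> :: nat \<Rightarrow> complex. (\<forall>j\<in>?A. norm (\<epsilon> j) = 1) \<longrightarrow>
      norm (\<Sum>j\<in>?A. \<epsilon> j *\<^sub>C b j) \<le> norm (\<Sum>j\<in>?A. b j)"
    and le: "\<forall>j\<in>?A. Re (cinner (\<Sum>k\<in>?A. b k) (b j)) \<le> 7 / 2"
  have max': "longest_csum ?A b" using max unfolding longest_csum_def .
  note cc = sup_norm_prod_cinner_ge[OF A bspec[OF unit] max' bspec[OF le[folded inner_eq_Re_cinner]],
      simplified card_atLeastAtMost diff_Suc_1]
  show "(\<forall>j\<in>?A. cinner (\<Sum>k\<in>?A. b k) (b j) \<in> \<real> \<and>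
                   Re (cinner (\<Sum>k\<in>?A. b k) (b j)) \<ge> 1) \<and>
      sup_norm (\<lambda>x. \<Prod>j\<in>?A. cinner x (b j)) \<ge> real n powr (- (real n / 2)) \<and>
      (sup_norm (\<lambda>x. \<Prod>j\<in>?A. cinner x (b j)) = real n powr (- (real n / 2)) \<longrightarrow>
         (\<forall>j\<in>?A. cinner (\<Sum>k\<in>?A. b k) (b j) = 1)) \<and>
      ((\<forall>j\<in>?A. cinner (\<Sum>k\<in>?A. b k) (b j) = 1) \<longleftrightarrow>
         (\<forall>i\<in>?A. \<forall>j\<in>?A. cinner (b i) (b j) = (if i = j then 1 else 0)))"
  proof (intro conjI impI iffI ballI)
    show "cinner (\<Sum>k\<in>?A. b k) (b j) \<in> \<real>" if "j \<in> ?A" for j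
      using longest_csum_cinner_real[OF A(1) max' that] unit that by blast
    show "1 \<le> Re (cinner (\<Sum>k\<in>?A. b k) (b j))" if "j \<in> ?A" for j
      using longest_sum_inner_ge_1[OF A(1) longest_csum_imp_longest_sum[OF max'] that] unit that
      by (simp add: inner_eq_Re_cinner)
    show "cinner (b i) (b j) = (if i = j then 1 else 0)"
      if "\<forall>j\<in>?A. cinner (\<Sum>k\<in>?A. b k) (b j) = 1" "i \<in> ?A" "j \<in> ?A" for i j
      using longest_csum_orthogonal[OF A(1) max' bspec[OF unit] bspec[OF that(1)] that(2,3)]
        unit that by (simp add: cinner_self)
    show "cinner (\<Sum>k\<in>?A. b k) (b j) = 1"
      if "\<forall>i\<in>?A. \<forall>j\<in>?A. cinner (b i) (b j) = (if i = j then 1 else 0)" "j \<in> ?A" for j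
      unfolding cinner_sum_left by (rule orthonormal_imp_inner_sum[OF A(1) that])
  qed (use cc in auto)
qed

end
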